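(* Let $P$ be a finite irreducible Markov chain on $V$ with stationary distribution $\pi$, and let $A\subset V$. Let $$\tilde\psi_{gl}(A)=\int_0^1\frac{\Psi(A^c,t)}{\pi(A)^2\pi(A^c)^2}\,dt,\qquad \psi_{mod}(A)=\int_0^1\frac{\Psi(A^c,t)}{t\,\pi(A)}\,dt,\qquad \tilde\psi^+(A)=\int_0^{\pi(A)}\frac{\Psi(A^c,t)}{\pi(A)^2\pi(A^c)^2}\,dt .$$ Then \begin{align*} 1-\mathcal C_{a(1-a)}(A)&=2\pi(A)\pi(A^c)\,\tilde\psi_{gl}(A),\\ 1-\mathcal C_{a\log(1/a)}(A)&=\frac{\psi_{mod}(A)}{\log\frac{1}{\pi(A)}},\\ 1-\mathcal C_{\sqrt{a(1-a)}}(A)&\ge\frac14\,\tilde\psi^+(A). \end{align*} The identity $1-\mathcal C_{\sqrt{a(1-a)}}(A)=1-\mathcal C_{\sqrt{a(1-a)}}(A^c)$ can be used when $\pi(A)>1/2$.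
   Context: $Q(A,B)=\sum_{x\in A,y\in B}\pi(x)P(x,y)$, $Q(A,y)=Q(A,\{y\})$; $A_u=\{y\in V:Q(A,y)\ge u\,\pi(y)\}$ for $u\in[0,1]$; for $f:[0,1]\to\mathbb R_+$, $\mathcal C_f(A)=\frac{\int_0^1 f(\pi(A_u))\,du}{f(\pi(A))}$, and a subscript such as $a(1-a)$ denotes the function $f(a)=a(1-a)$ (with $a\log(1/a)=0$ at $a=0$). These quantities are defined for $A\neq\emptyset,V$. For $t\le\pi(A^c)$, $$\Psi(A,t)=\min_{\substack{B\subset V,\ v\in V\\ \pi(B)\le t,\ \pi(B\cup\{v\})>t}}\ Q(A,B)+(t-\pi(B))\frac{Q(A,v)}{\pi(v)},$$ and $\Psi(A,t)=\Psi(A^c,1-t)$ when $t>\pi(A^c)$. (So $\Psi(A^c,t)$ is given by the minimum formula, with $A^c$ in place of $A$, for $t\le\pi(A)$, and equals $\Psi(A,1-t)$ for $t>\pi(A)$.)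
   Formalization: The third inequality is proved only for π(A) ≤ 1/2 (for larger π(A) apply it to A^c via the identity, which is proved for all A); without this it fails, e.g. for P(x,y)=π(y) with π(A) > 7/8. *)

theory Defs
  imports "HOL-Analysis.Analysis"
begin

(* The state space V is the universe of the finite type 'v. *)

definition markov_kernel :: "('v::finite \<Rightarrow> 'v \<Rightarrow> real) \<Rightarrow> bool" where
  "markov_kernel P \<longleftrightarrow> (\<forall>x y. 0 \<le> P x y) \<and> (\<forall>x. (\<Sum>y\<in>UNIV. P x y) = 1)"

primrec step_prob :: "('v::finite \<Rightarrow> 'v \<Rightarrow> real) \<Rightarrow> nat \<Rightarrow> 'v \<Rightarrow> 'v \<Rightarrow> real" where
  "step_prob P 0 x y = (if x = y then 1 else 0)"
| "step_prob P (Suc n) x y = (\<Sum>z\<in>UNIV. P x z * step_prob P n z y)"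

definition irreducible_kernel :: "('v::finite \<Rightarrow> 'v \<Rightarrow> real) \<Rightarrow> bool" where
  "irreducible_kernel P \<longleftrightarrow> (\<forall>x y. \<exists>n. 0 < step_prob P n x y)"

definition stationary_distribution ::
    "('v::finite \<Rightarrow> 'v \<Rightarrow> real) \<Rightarrow> ('v \<Rightarrow> real) \<Rightarrow> bool" where
  "stationary_distribution P \<pi> \<longleftrightarrow>
     (\<forall>x. 0 \<le> \<pi> x) \<and> (\<Sum>x\<in>UNIV. \<pi> x) = 1 \<and>
     (\<forall>y. (\<Sum>x\<in>UNIV. \<pi> x * P x y) = \<pi> y)"

definition flow :: "('v::finite \<Rightarrow> 'v \<Rightarrow> real) \<Rightarrow> ('v \<Rightarrow> real) \<Rightarrow> 'v set \<Rightarrow> 'v set \<Rightarrow> real" where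
  "flow P \<pi> A B = (\<Sum>x\<in>A. \<Sum>y\<in>B. \<pi> x * P x y)"

definition evolve ::
    "('v::finite \<Rightarrow> 'v \<Rightarrow> real) \<Rightarrow> ('v \<Rightarrow> real) \<Rightarrow> 'v set \<Rightarrow> real \<Rightarrow> 'v set" where
  "evolve P \<pi> A u = {y. flow P \<pi> A {y} \<ge> u * \<pi> y}"

definition cong_quot ::
    "('v::finite \<Rightarrow> 'v \<Rightarrow> real) \<Rightarrow> ('v \<Rightarrow> real) \<Rightarrow> (real \<Rightarrow> real) \<Rightarrow> 'v set \<Rightarrow> real" where
  "cong_quot P \<pi> f A = integral {0..1} (\<lambda>u. f (sum \<pi> (evolve P \<pi> A u))) / f (sum \<pi> A)"

definition min_flow ::
    "('v::finite \<Rightarrow> 'v \<Rightarrow> real) \<Rightarrow> ('v \<Rightarrow> real) \<Rightarrow> 'v set \<Rightarrow> real \<Rightarrow> real" where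
  "min_flow P \<pi> A t =
     Min {flow P \<pi> A B + (t - sum \<pi> B) * (flow P \<pi> A {v} / \<pi> v) |
          B v. sum \<pi> B \<le> t \<and> sum \<pi> (B \<union> {v}) > t}"

(* For sum \<pi> (- A) < t \<le> 1 we have 0 \<le> 1 - t < sum \<pi> A, so blocking (- A) (1 - t)
   is itself given by the minimum formula; this is what the second branch says. The
   minimum ranges over a nonempty set whenever 0 \<le> t < 1. *)
definition blocking ::
    "('v::finite \<Rightarrow> 'v \<Rightarrow> real) \<Rightarrow> ('v \<Rightarrow> real) \<Rightarrow> 'v set \<Rightarrow> real \<Rightarrow> real" where
  "blocking P \<pi> A t =
     (if t \<le> sum \<pi> (- A) then min_flow P \<pi> A t else min_flow P \<pi> (- A) (1 - t))"

definition psi_gl :: "('v::finite \<Rightarrow> 'v \<Rightarrow> real) \<Rightarrow> ('v \<Rightarrow> real) \<Rightarrow> 'v set \<Rightarrow> real" where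
  "psi_gl P \<pi> A =
     integral {0..1} (\<lambda>t. blocking P \<pi> (- A) t / ((sum \<pi> A)\<^sup>2 * (sum \<pi> (- A))\<^sup>2))"

definition psi_mod :: "('v::finite \<Rightarrow> 'v \<Rightarrow> real) \<Rightarrow> ('v \<Rightarrow> real) \<Rightarrow> 'v set \<Rightarrow> real" where
  "psi_mod P \<pi> A = integral {0..1} (\<lambda>t. blocking P \<pi> (- A) t / (t * sum \<pi> A))"

definition psi_plus :: "('v::finite \<Rightarrow> 'v \<Rightarrow> real) \<Rightarrow> ('v \<Rightarrow> real) \<Rightarrow> 'v set \<Rightarrow> real" where
  "psi_plus P \<pi> A =
     integral {0..sum \<pi> A} (\<lambda>t. blocking P \<pi> (- A) t / ((sum \<pi> A)\<^sup>2 * (sum \<pi> (- A))\<^sup>2))"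

end

(* Write a = pi(A) and m(u) = pi(A_u). Filling up greedily along the order of Q(A,y)/pi(y) solves
   the fractional knapsack problem defining Psi, so Psi(A^c,t) is the integral over u of the
   positive part of t - m(u) if t <= a, and of m(u) - t if t > a. For concave f, Taylor's formula
   with integral remainder at a, integrated over u (the linear term vanishes because m has mean a),
   gives f(a) - int f(m(u)) du = int -f''(t) Psi(A^c,t) dt. The functions a(1-a) and a log(1/a)
   yield the two identities. For sqrt(a(1-a)) the singularities of f'' are avoided by a pointwise
   quadratic bound that uses only the second derivative at a <= 1/2. *)
theory Submission
  imports Defs
begin

section \<open>Level integrals as finite weighted sums\<close>

text \<open>The superlevel sets take finitely many values \<open>D\<close>, and \<open>w D\<close> is the length of the set of
  levels at which \<open>D\<close> occurs; this turns all exchanges of integrals into finite sums.\<close>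

lemma superlevel_integral_weights:
  fixes c :: "'v::finite \<Rightarrow> real"
  obtains w :: "'v set \<Rightarrow> real"
  where "\<forall>D. 0 \<le> w D" and "\<forall>D. w D \<noteq> 0 \<longrightarrow> (\<exists>u. D = {y. u \<le> c y})"
    and "\<forall>F. ((\<lambda>u. F {y. u \<le> c y}) has_integral (\<Sum>D\<in>UNIV. w D * F D)) {0..1}"
proof -
  define E where "E D = {u \<in> {0..1}. {y. u \<le> c y} = D}" for D
  define w where "w D = measure lebesgue (E D)" for D
  \<comment> \<open>A finite intersection of half-lines, hence measurable.\<close>
  have "E D = {0..1} \<inter> (\<Inter>y. if y \<in> D then {..c y} else {c y<..})" for D
  proof -
    have "{y. u \<le> c y} = D \<longleftrightarrow> (\<forall>y. u \<in> (if y \<in> D then {..c y} else {c y<..}))" for u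
      unfolding set_eq_iff by (intro all_cong1) auto
    then show ?thesis by (auto simp only: E_def INT_iff)
  qed
  moreover have "(\<Inter>y. if y \<in> D then {..c y} else {c y<..}) \<in> sets lebesgue" for D
    by (rule sets.finite_INT) auto
  ultimately have "E D \<in> sets lebesgue" for D by auto
  moreover have "bounded (E D)" for D
    by (rule bounded_subset[of "{0..1}"]) (auto simp: E_def)
  ultimately have meas: "E D \<in> lmeasurable" for D
    by (simp add: bounded_set_imp_lmeasurable)
  have ind: "(indicat_real (E D) has_integral w D) {0..1}" for D
  proof -
    have "(indicat_real (E D) has_integral w D) UNIV"
      using meas lmeasurable_iff_indicator_has_integral w_def by blast
    then have "((\<lambda>u. if u \<in> {0..1} then indicat_real (E D) u else 0) has_integral w D) UNIV"
      by (rule has_integral_eq[rotated]) (auto simp: E_def)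
    then show ?thesis by (simp only: has_integral_restrict_UNIV)
  qed
  have "\<exists>u. D = {y. u \<le> c y}" if "w D \<noteq> 0" for D
  proof -
    have "E D \<noteq> {}" using that by (auto simp: w_def)
    then show ?thesis by (auto simp: E_def)
  qed
  moreover have "((\<lambda>u. F {y. u \<le> c y}) has_integral (\<Sum>D\<in>UNIV. w D * F D)) {0..1}" for F
  proof (rule has_integral_eq)
    show "((\<lambda>u. \<Sum>D\<in>UNIV. indicat_real (E D) u * F D) has_integral
        (\<Sum>D\<in>UNIV. w D * F D)) {0..1}"
      by (intro has_integral_sum has_integral_mult_left ind) auto
    show "(\<Sum>D\<in>UNIV. indicat_real (E D) u * F D) = F {y. u \<le> c y}" if "u \<in> {0..1}" for u
    proof -
      \<comment> \<open>Each level \<open>u\<close> lies in exactly one \<open>E D\<close>, so a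
        single summand survives.\<close>
      have "(\<Sum>D\<in>UNIV. indicat_real (E D) u * F D)
          = (\<Sum>D\<in>UNIV. if D = {y. u \<le> c y} then F D else 0)"
        using that by (intro sum.cong) (auto simp: E_def indicator_def)
      then show ?thesis by simp
    qed
  qed
  ultimately show thesis
    by (intro that[of w] allI impI) (auto simp: w_def)
qed

section \<open>The fractional knapsack problem\<close>

text \<open>The objective is linear in the costs \<open>c\<close>, and \<open>c\<close> is a mixture
  of indicators of sets \<open>D\<close>. When the cost is the indicator of one \<open>D\<close>,
  only the mass of \<open>- D\<close> is free, so filling up to \<open>t\<close> costs at least the
  positive part of \<open>t - sum p (- D)\<close>. The sets of nonzero weight are upward closed in
  the order of \<open>c\<close>, so one greedy filling attains all these bounds at once.\<close>

lemma fractional_knapsack: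
  fixes p c :: "'v::finite \<Rightarrow> real" and w :: "'v set \<Rightarrow> real"
  assumes p: "\<And>y. 0 \<le> p y" and w: "\<And>D. 0 \<le> w D"
    and up: "\<And>D y z. w D \<noteq> 0 \<Longrightarrow> y \<in> D \<Longrightarrow> c y \<le> c z \<Longrightarrow> z \<in> D"
    and c: "\<And>y. c y = (\<Sum>D\<in>UNIV. w D * (if y \<in> D then 1 else 0))"
    and t: "0 \<le> t" "t < sum p UNIV"
  shows "Min {(\<Sum>y\<in>B. p y * c y) + (t - sum p B) * c v | B v. sum p B \<le> t \<and> sum p (B \<union> {v}) > t}
    = (\<Sum>D\<in>UNIV. w D * max 0 (t - sum p (- D)))"
proof -
  have mono: "sum p X \<le> sum p Y" if "X \<subseteq> Y" for X Y
    using that p by (simp add: sum_mono2)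
  have expand: "(\<Sum>y\<in>B. p y * c y) + (t - sum p B) * c v
      = (\<Sum>D\<in>UNIV. w D * (sum p (B \<inter> D) + (t - sum p B) * (if v \<in> D then 1 else 0)))" for B v
  proof -
    have "(\<Sum>y\<in>B. p y * c y) = (\<Sum>D\<in>UNIV. w D * (\<Sum>y\<in>B. p y * (if y \<in> D then 1 else 0)))"
      unfolding c sum_distrib_left by (subst sum.swap) (simp add: mult_ac)
    moreover have "(\<Sum>y\<in>B. p y * (if y \<in> D then 1 else 0)) = sum p (B \<inter> D)" for D
      by (simp add: sum.inter_restrict if_distrib cong: if_cong)
    ultimately show ?thesis
      by (simp add: c[of v] sum_distrib_left sum.distrib[symmetric] algebra_simps)
  qed
  have split: "sum p B = sum p (B \<inter> D) + sum p (B - D)" for B D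
    by (simp add: sum.Int_Diff)
  \<comment> \<open>For \<open>v\<close> in \<open>D\<close> the right side is
    \<open>t - sum p (B - D)\<close>. Otherwise \<open>B \<union> {v}\<close> exceeds
    \<open>t\<close>, and \<open>B \<inter> D\<close> must contain the mass that \<open>- D\<close>
    cannot hold.\<close>
  have lower: "max 0 (t - sum p (- D)) \<le> sum p (B \<inter> D) + (t - sum p B) * (if v \<in> D then 1 else 0)"
    if "sum p B \<le> t" "sum p (B \<union> {v}) > t" for B v D
  proof -
    have "0 \<le> sum p (B \<inter> D)" "sum p (B - D) \<le> sum p (- D)"
      using p by (auto intro: sum_nonneg mono)
    moreover have "sum p (B \<union> {v}) \<le> sum p (B \<inter> D) + sum p (- D)" if "v \<notin> D"
      using split[of "B \<union> {v}" D] that mono[of "(B \<union> {v}) - D" "- D"]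
        mono[of "(B \<union> {v}) \<inter> D" "B \<inter> D"] by auto
    ultimately show ?thesis using that split[of B D] by auto
  qed
  \<comment> \<open>The critical cost \<open>l\<close> is the least value of \<open>c\<close> at
    which taking all items up to that cost overshoots \<open>t\<close>.\<close>
  obtain l where l: "t < sum p {y. c y \<le> l}" "sum p {y. c y < l} \<le> t"
  proof -
    define L where "L = {x \<in> range c. t < sum p {y. c y \<le> x}}"
    have "Max (range c) \<in> L"
    proof -
      have "{y. c y \<le> Max (range c)} = UNIV" by auto
      moreover have "Max (range c) \<in> range c" by (rule Max_in) auto
      ultimately show ?thesis using t by (simp only: L_def mem_Collect_eq)
    qed
    then have "L \<noteq> {}" by blast
    moreover have "finite L" by (simp add: L_def)
    ultimately have Min: "Min L \<in> L" and least: "\<And>x. x \<in> L \<Longrightarrow> Min L \<le> x" by auto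
    have "sum p {y. c y < Min L} \<le> t"
    proof (cases "{y. c y < Min L} = {}")
      case False
      define x where "x = Max (c ` {y. c y < Min L})"
      have x: "x \<in> c ` {y. c y < Min L}" using False by (auto simp: x_def intro!: Max_in)
      then have "x \<notin> L" using least[of x] by fastforce
      then have "sum p {y. c y \<le> x} \<le> t" using x by (auto simp: L_def)
      moreover have "{y. c y < Min L} \<subseteq> {y. c y \<le> x}" by (auto simp: x_def)
      ultimately show ?thesis using mono[of "{y. c y < Min L}" "{y. c y \<le> x}"] by linarith
    next
      case True
      then show ?thesis using t by simp
    qed
    then show thesis using that Min by (auto simp: L_def)
  qed
  \<comment> \<open>Greedy filling takes everything cheaper than \<open>l\<close> and then a maximal
    choice of items of cost \<open>l\<close>. Any further item \<open>v\<close> of cost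
    \<open>l\<close> overshoots \<open>t\<close>, which makes the pair of \<open>B\<close> and
    \<open>v\<close> admissible.\<close>
  define \<B> where "\<B> = {B. {y. c y < l} \<subseteq> B \<and> B \<subseteq> {y. c y \<le> l} \<and> sum p B \<le> t}"
  have "{y. c y < l} \<in> \<B>" using l by (auto simp: \<B>_def)
  then have "\<B> \<noteq> {}" by blast
  then obtain B where B: "B \<in> \<B>" and maximal: "\<And>C. C \<in> \<B> \<Longrightarrow> B \<subseteq> C \<Longrightarrow> B = C"
    using finite_has_maximal[of \<B>] finite[of \<B>] by metis
  have "B \<noteq> {y. c y \<le> l}" using B l by (auto simp: \<B>_def)
  then obtain v where v: "c v \<le> l" "v \<notin> B" using B by (auto simp: \<B>_def)
  then have "B \<union> {v} \<notin> \<B>" using maximal[of "B \<union> {v}"] by auto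
  then have Bv: "sum p (B \<union> {v}) > t" "sum p B \<le> t"
    using B v by (auto simp: \<B>_def)
  have "\<not> c v < l" using v(2) B by (auto simp: \<B>_def)
  then have cv: "c v = l" using v(1) by simp
  \<comment> \<open>If \<open>v\<close> is in \<open>D\<close>, all of \<open>- D\<close> is cheaper
    than \<open>l\<close> and so lies in \<open>B\<close>. If not, \<open>D\<close> has only items
    dearer than \<open>l\<close>, so \<open>B\<close> misses \<open>D\<close> and the cost is
    zero.\<close>
  have opt: "w D * (sum p (B \<inter> D) + (t - sum p B) * (if v \<in> D then 1 else 0))
      = w D * max 0 (t - sum p (- D))" for D
  proof (cases "w D = 0")
    case False
    show ?thesis
    proof (cases "v \<in> D")
      case True
      then have sub: "- D \<subseteq> B"
        using up[OF False True] cv B unfolding \<B>_def by (metis (mono_tags, lifting) ComplD linorder_not_le mem_Collect_eq subset_iff)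
      then have "B - D = - D" by auto
      then show ?thesis using True split[of B D] mono[OF sub] Bv by auto
    next
      case vD: False
      then have "B \<inter> D = {}"
        using up[OF False, of _ v] cv B by (auto simp: \<B>_def)
      moreover from this have "sum p (B \<union> {v}) \<le> sum p (- D)"
        using vD by (intro mono) auto
      ultimately show ?thesis using vD Bv by auto
    qed
  qed simp
  show ?thesis
  proof (rule Min_eqI)
    show "finite {(\<Sum>y\<in>B. p y * c y) + (t - sum p B) * c v | B v. sum p B \<le> t \<and> sum p (B \<union> {v}) > t}"
      by (rule finite_subset[of _ "range (\<lambda>(B, v). (\<Sum>y\<in>B. p y * c y) + (t - sum p B) * c v)"])
        auto
    show "(\<Sum>D\<in>UNIV. w D * max 0 (t - sum p (- D))) \<le> x"
      if "x \<in> {(\<Sum>y\<in>B. p y * c y) + (t - sum p B) * c v | B v. sum p B \<le> t \<and> sum p (B \<union> {v}) > t}" for x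
      using that w lower by (auto simp only: expand mem_Collect_eq intro!: sum_mono mult_left_mono)
    show "(\<Sum>D\<in>UNIV. w D * max 0 (t - sum p (- D)))
        \<in> {(\<Sum>y\<in>B. p y * c y) + (t - sum p B) * c v | B v. sum p B \<le> t \<and> sum p (B \<union> {v}) > t}"
      using Bv expand[of B v] by (auto simp only: opt mem_Collect_eq intro!: exI[of _ B] exI[of _ v])
  qed
qed

section \<open>Stationarity and the ratios Q(A,y)/pi(y)\<close>

lemma stationary_step_prob:
  assumes "stationary_distribution P \<pi>"
  shows "(\<Sum>x\<in>UNIV. \<pi> x * step_prob P n x y) = \<pi> y"
proof (induction n)
  case 0
  then show ?case by (simp add: if_distrib cong: if_cong)
next
  case (Suc n)
  have "(\<Sum>x\<in>UNIV. \<pi> x * step_prob P (Suc n) x y)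
      = (\<Sum>z\<in>UNIV. (\<Sum>x\<in>UNIV. \<pi> x * P x z) * step_prob P n z y)"
    by (simp add: sum_distrib_left sum_distrib_right mult.assoc) (rule sum.swap)
  then show ?case using Suc assms by (simp add: stationary_distribution_def)
qed

lemma step_prob_nonneg: "markov_kernel P \<Longrightarrow> 0 \<le> step_prob P n x y"
  by (induction n arbitrary: x) (auto simp: markov_kernel_def intro!: sum_nonneg)

text \<open>Some state carries mass, irreducibility sends a positive share of it to \<open>y\<close>
  in \<open>n\<close> steps, and \<open>\<pi>\<close> is invariant under \<open>n\<close> steps.
  This justifies dividing by \<open>\<pi> y\<close> throughout.\<close>

lemma stationary_positive:
  assumes "markov_kernel P" "irreducible_kernel P" and st: "stationary_distribution P \<pi>"
  shows "0 < \<pi> y"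
proof -
  have nn: "\<And>x. 0 \<le> \<pi> x" and one: "sum \<pi> UNIV = 1"
    using st by (auto simp: stationary_distribution_def)
  then obtain x where "\<pi> x \<noteq> 0" by (metis sum.neutral zero_neq_one)
  then have "0 < \<pi> x" using nn[of x] by linarith
  moreover obtain n where "0 < step_prob P n x y"
    using assms(2) by (auto simp: irreducible_kernel_def)
  ultimately have "0 < \<pi> x * step_prob P n x y" by simp
  also have "\<dots> \<le> (\<Sum>x\<in>UNIV. \<pi> x * step_prob P n x y)"
    by (rule member_le_sum) (auto simp: nn step_prob_nonneg assms)
  finally show ?thesis using stationary_step_prob[OF st] by simp
qed

text \<open>The total flow into \<open>y\<close> is \<open>\<pi> y\<close> by stationarity. Passing
  to the complement therefore reverses the order of the ratios.\<close>

lemma flow_ratio_compl: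
  assumes "stationary_distribution P \<pi>" "0 < \<pi> y"
  shows "flow P \<pi> (- A) {y} / \<pi> y = 1 - flow P \<pi> A {y} / \<pi> y"
proof -
  have "flow P \<pi> (- A) {y} + flow P \<pi> A {y} = (\<Sum>x\<in>UNIV. \<pi> x * P x y)"
    unfolding flow_def by (subst sum.union_disjoint[symmetric]) auto
  then show ?thesis using assms by (auto simp: stationary_distribution_def field_simps)
qed

lemma flow_ratio_nonneg:
  assumes "markov_kernel P" "stationary_distribution P \<pi>"
  shows "0 \<le> flow P \<pi> A {y} / \<pi> y"
  using assms by (auto simp: flow_def markov_kernel_def stationary_distribution_def
      intro!: divide_nonneg_nonneg sum_nonneg)

text \<open>In this form the flow is a knapsack cost with masses \<open>\<pi>\<close> and the ratios
  as unit costs.\<close>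

lemma flow_eq_sum_ratio:
  assumes "\<And>y. 0 < \<pi> y"
  shows "flow P \<pi> A B = (\<Sum>y\<in>B. \<pi> y * (flow P \<pi> A {y} / \<pi> y))"
proof -
  have "\<pi> y \<noteq> 0" for y using assms[of y] by simp
  then show ?thesis unfolding flow_def by (simp add: sum.swap[of _ A B])
qed

section \<open>The function Psi(A^c,t) as a mixture of Peano kernels\<close>

text \<open>The Peano kernel of the first-order Taylor expansion at \<open>a\<close>, evaluated at \<open>m\<close>.\<close>

definition deviation :: "real \<Rightarrow> real \<Rightarrow> real \<Rightarrow> real" where
  "deviation a m t = (if t \<le> a then max 0 (t - m) else max 0 (m - t))"

text \<open>Reduces the chain to a probability vector \<open>w\<close> on sets, with mean measure
  pi(A). Both the integrals over \<open>u\<close> and the function Psi(A^c,t) become sums against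
  the same \<open>w\<close>, which is all that the main proof uses.\<close>

lemma evolve_weights:
  fixes P :: "'v::finite \<Rightarrow> 'v \<Rightarrow> real"
  assumes "markov_kernel P" "irreducible_kernel P" and st: "stationary_distribution P \<pi>"
    and "A \<noteq> UNIV"
  obtains w :: "'v set \<Rightarrow> real"
  where "\<forall>D. 0 \<le> w D"
    and "\<forall>F. ((\<lambda>u. F (evolve P \<pi> A u)) has_integral (\<Sum>D\<in>UNIV. w D * F D)) {0..1}"
    and "(\<Sum>D\<in>UNIV. w D) = 1" and "(\<Sum>D\<in>UNIV. w D * sum \<pi> D) = sum \<pi> A"
    and "\<forall>t\<in>{0..1}.
      blocking P \<pi> (- A) t = (\<Sum>D\<in>UNIV. w D * deviation (sum \<pi> A) (sum \<pi> D) t)"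
proof -
  have pos: "\<And>y. 0 < \<pi> y" using stationary_positive assms by blast
  have one: "sum \<pi> UNIV = 1" using st by (simp add: stationary_distribution_def)
  have nn: "\<And>y. 0 \<le> \<pi> y" using pos by (simp add: less_imp_le)
  define g where "g A y = flow P \<pi> A {y} / \<pi> y" for A y
  have g_compl: "g (- A) y = 1 - g A y" for A y
    using flow_ratio_compl[OF st pos] by (simp add: g_def)
  have g_nonneg: "0 \<le> g A y" for A y
    using flow_ratio_nonneg assms by (auto simp: g_def)
  have g_le: "g A y \<le> 1" for A y
    using g_compl[of A y] g_nonneg[of "- A" y] by simp
  have evolve: "evolve P \<pi> A u = {y. u \<le> g A y}" for u
    using pos by (auto simp: evolve_def g_def pos_le_divide_eq)
  have flow: "flow P \<pi> A B = (\<Sum>y\<in>B. \<pi> y * g A y)" for A B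
    unfolding g_def by (rule flow_eq_sum_ratio[OF pos])
  have min_flow: "min_flow P \<pi> A t = Min {(\<Sum>y\<in>B. \<pi> y * g A y) + (t - sum \<pi> B) * g A v | B v.
      sum \<pi> B \<le> t \<and> sum \<pi> (B \<union> {v}) > t}" for A t
    unfolding min_flow_def g_def[symmetric] unfolding flow ..
  obtain w :: "'v set \<Rightarrow> real" where w': "\<forall>D. 0 \<le> w D" and supp': "\<forall>D. w D \<noteq> 0 \<longrightarrow> (\<exists>u. D = {y. u \<le> g A y})"
    and int': "\<forall>F. ((\<lambda>u. F {y. u \<le> g A y}) has_integral (\<Sum>D\<in>UNIV. w D * F D)) {0..1}"
    by (rule superlevel_integral_weights[of "g A"]) (rule that)
  note w = w'[rule_format] and supp = supp'[rule_format] and int = int'[rule_format]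
  have w_one: "(\<Sum>D\<in>UNIV. w D) = 1"
    using int[of "\<lambda>_. 1"] has_integral_const_real[of "1::real" 0 1]
    by (auto dest: has_integral_unique)
  \<comment> \<open>Layer-cake formula: the levels \<open>u\<close> in [0,1] with
    \<open>u \<le> g A y\<close> have total length \<open>g A y\<close>.\<close>
  have layer: "g A y = (\<Sum>D\<in>UNIV. w D * (if y \<in> D then 1 else 0))" for y
  proof -
    have "((\<lambda>u. 1) has_integral g A y) {0..g A y}"
      using has_integral_const_real[of "1::real" 0 "g A y"] g_nonneg[of A y] by simp
    then have "((\<lambda>u. if u \<in> {0..g A y} then 1 else 0) has_integral g A y) {0..1::real}"
      using g_le[of A y] by (subst has_integral_restrict) auto
    then have "((\<lambda>u. if y \<in> {y. u \<le> g A y} then 1 else 0) has_integral g A y) {0..1::real}"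
      by (rule has_integral_eq[rotated]) auto
    then show ?thesis using int[of "\<lambda>D. if y \<in> D then 1 else 0"] has_integral_unique by blast
  qed
  \<comment> \<open>Since \<open>g (- A) = 1 - g A\<close>, the weights for \<open>- A\<close> are
    those for \<open>A\<close> carried over by complementation.\<close>
  have layer_compl: "g (- A) y = (\<Sum>D\<in>UNIV. w (- D) * (if y \<in> D then 1 else 0))" for y
  proof -
    have "(\<Sum>D\<in>UNIV. w (- D) * (if y \<in> D then 1 else 0))
        = (\<Sum>D\<in>UNIV. w D * (if y \<notin> D then 1 else 0))"
      by (rule sum.reindex_bij_witness[of _ uminus uminus]) auto
    also have "\<dots> = (\<Sum>D\<in>UNIV. w D) - (\<Sum>D\<in>UNIV. w D * (if y \<in> D then 1 else 0))"
      by (subst sum_subtractf[symmetric]) (auto intro!: sum.cong)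
    finally show ?thesis using w_one layer g_compl by simp
  qed
  have meas_compl: "sum \<pi> (- D) = 1 - sum \<pi> D" for D
    using one by (simp add: Compl_eq_Diff_UNIV sum_diff)
  have mf: "min_flow P \<pi> A t = (\<Sum>D\<in>UNIV. w D * max 0 (t - sum \<pi> (- D)))" if "0 \<le> t" "t < 1" for t
    unfolding min_flow
  proof (rule fractional_knapsack)
    show "z \<in> D" if "w D \<noteq> 0" "y \<in> D" "g A y \<le> g A z" for D y z
      using supp[OF that(1)] that(2,3) by auto
  qed (use that one in \<open>auto simp: nn w intro!: layer\<close>)
  have mf_compl: "min_flow P \<pi> (- A) t = (\<Sum>D\<in>UNIV. w D * max 0 (t - sum \<pi> D))"
    if "0 \<le> t" "t < 1" for t
  proof -
    have "min_flow P \<pi> (- A) t = (\<Sum>D\<in>UNIV. w (- D) * max 0 (t - sum \<pi> (- D)))"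
      unfolding min_flow
    proof (rule fractional_knapsack)
      show "z \<in> D" if supp_D: "w (- D) \<noteq> 0" and up: "y \<in> D" "g (- A) y \<le> g (- A) z" for D y z
      proof -
        obtain u where u: "- D = {y. u \<le> g A y}" using supp[OF supp_D] by blast
        have "x \<in> D \<longleftrightarrow> g A x < u" for x
          using arg_cong[OF u, of "\<lambda>X. x \<in> X"] by auto
        then show ?thesis using up by (simp add: g_compl)
      qed
    qed (use that one in \<open>auto simp: nn w intro!: layer_compl\<close>)
    also have "\<dots> = (\<Sum>D\<in>UNIV. w D * max 0 (t - sum \<pi> D))"
      by (rule sum.reindex_bij_witness[of _ uminus uminus]) auto
    finally show ?thesis .
  qed
  show thesis
  proof (rule that[of w])
    \<comment> \<open>The mean size of A_u is the total flow Q(A,V), which is pi(A) because the rows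
      of \<open>P\<close> sum to 1.\<close>
    show "(\<Sum>D\<in>UNIV. w D * sum \<pi> D) = sum \<pi> A"
    proof -
      have "(\<Sum>D\<in>UNIV. w D * sum \<pi> D)
          = (\<Sum>D\<in>UNIV. w D * (\<Sum>y\<in>UNIV. \<pi> y * (if y \<in> D then 1 else 0)))"
        by (simp add: if_distrib sum.If_cases cong: if_cong)
      also have "\<dots> = (\<Sum>y\<in>UNIV. \<pi> y * g A y)"
        unfolding layer sum_distrib_left by (subst sum.swap) (simp add: mult_ac)
      also have "\<dots> = flow P \<pi> A UNIV" by (simp add: flow)
      also have "\<dots> = sum \<pi> A"
        using assms(1) by (simp add: flow_def markov_kernel_def sum_distrib_left[symmetric])
      finally show ?thesis .
    qed
    show "\<forall>t\<in>{0..1}. blocking P \<pi> (- A) t = (\<Sum>D\<in>UNIV. w D * deviation (sum \<pi> A) (sum \<pi> D) t)"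
    proof
      fix t :: real assume "t \<in> {0..1}"
      have "sum \<pi> (- A) > 0" using assms pos by (intro sum_pos) auto
      \<comment> \<open>These bounds keep the argument of \<open>min_flow\<close> in [0,1) in both
        branches: it is \<open>t\<close>, at most pi(A), in the first, and \<open>1 - t\<close> with
        \<open>t\<close> positive in the second.\<close>
      then have "sum \<pi> A < 1" "sum \<pi> A \<ge> 0"
        using meas_compl[of A] nn by (auto intro: sum_nonneg)
      then show "blocking P \<pi> (- A) t = (\<Sum>D\<in>UNIV. w D * deviation (sum \<pi> A) (sum \<pi> D) t)"
        using \<open>t \<in> {0..1}\<close> by (auto simp: blocking_def deviation_def mf mf_compl meas_compl)
    qed
  qed (use w w_one int in \<open>auto simp: evolve\<close>)
qed

section \<open>Integrals of the Peano kernel\<close>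

text \<open>The kernel lives between \<open>a\<close> and \<open>m\<close>, where it is
  \<open>t - m\<close> or its negative, and the sign matches the orientation of the interval. With
  \<open>h\<close> equal to -f'' and \<open>F t = f t - (t - m) * f' t\<close>, the value is the gap
  at \<open>m\<close> between the tangent of f at \<open>a\<close> and f itself.\<close>

lemma has_integral_deviation_times:
  assumes S: "{min a m..max a m} \<subseteq> S"
    and F: "\<And>t. t \<in> {min a m..max a m} \<Longrightarrow> (F has_real_derivative (t - m) * h t) (at t within {min a m..max a m})"
  shows "((\<lambda>t. deviation a m t * h t) has_integral F a - F m) S"
proof (rule has_integral_on_superset[OF _ _ S])
  show "deviation a m t * h t = 0" if "t \<notin> {min a m..max a m}" for t
    using that by (cases "m \<le> a") (auto simp: deviation_def)
  show "((\<lambda>t. deviation a m t * h t) has_integral F a - F m) {min a m..max a m}"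
  proof (cases "m \<le> a")
    case True
    have "((\<lambda>t. (t - m) * h t) has_integral F a - F m) {m..a}"
      using True F by (intro fundamental_theorem_of_calculus)
        (auto simp: has_real_derivative_iff_has_vector_derivative[symmetric])
    then show ?thesis using True
      by (auto simp: deviation_def elim!: has_integral_eq[rotated])
  next
    case False
    have "((\<lambda>t. (t - m) * h t) has_integral F m - F a) {a..m}"
      using False F by (intro fundamental_theorem_of_calculus)
        (auto simp: has_real_derivative_iff_has_vector_derivative[symmetric])
    from has_integral_neg[OF this]
    have "((\<lambda>t. - ((t - m) * h t)) has_integral F a - F m) {a..m}" by simp
    \<comment> \<open>At \<open>t = a\<close> the first branch of \<open>deviation\<close> applies
      and gives 0 instead of \<open>m - a\<close>, so this point is discarded.\<close>
    then have "((\<lambda>t. deviation a m t * h t) has_integral F a - F m) {a..m}"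
      by (rule has_integral_spike_finite[of "{a}", rotated -1]) (auto simp: deviation_def algebra_simps)
    then show ?thesis using False by simp
  qed
qed

lemma has_integral_deviation:
  assumes "{min a m..max a m} \<subseteq> S"
  shows "(deviation a m has_integral (a - m)\<^sup>2 / 2) S"
proof -
  have "((\<lambda>t. deviation a m t * 1) has_integral (a - m)\<^sup>2 / 2 - (m - m)\<^sup>2 / 2) S"
    by (rule has_integral_deviation_times[where F = "\<lambda>t. (t - m)\<^sup>2 / 2", OF assms])
      (auto intro!: derivative_eq_intros)
  then show ?thesis by simp
qed

text \<open>Here 1/t is -f'' for f(t) = t log(1/t), with antiderivative \<open>t - m * ln t\<close>.
  For \<open>m = 0\<close> the interval reaches the singularity at 0, but the quotient is 1 on the
  rest of (0,a].\<close>

lemma has_integral_deviation_divide: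
  assumes "0 < a" "a \<le> 1" "0 \<le> m" "m \<le> 1"
  shows "((\<lambda>t. deviation a m t / t) has_integral m * ln m - m * ln a - m + a) {0..1}"
proof (cases "m = 0")
  case True
  have "((\<lambda>t. 1) has_integral a) {0..a}"
    using has_integral_const_real[of "1::real" 0 a] assms by simp
  then have "((\<lambda>t. deviation a 0 t / t) has_integral a) {0..a}"
    by (rule has_integral_spike_finite[of "{0}", rotated -1]) (auto simp: deviation_def)
  then have "((\<lambda>t. deviation a 0 t / t) has_integral a) {0..1}"
    by (rule has_integral_on_superset) (use assms in \<open>auto simp: deviation_def\<close>)
  then show ?thesis using True by simp
next
  case False
  then have m: "0 < m" using assms by simp
  have "((\<lambda>t. deviation a m t * (1 / t)) has_integral (a - m * ln a) - (m - m * ln m)) {0..1}"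
  proof (rule has_integral_deviation_times[where F = "\<lambda>t. t - m * ln t"])
    show "((\<lambda>t. t - m * ln t) has_real_derivative (t - m) * (1 / t)) (at t within {min a m..max a m})"
      if "t \<in> {min a m..max a m}" for t
    proof -
      have "0 < t" using that m assms by (auto simp: min_def split: if_splits)
      then show ?thesis by (auto intro!: derivative_eq_intros simp: field_simps)
    qed
  qed (use assms in auto)
  then show ?thesis by (simp add: algebra_simps)
qed

section \<open>A quadratic upper bound for sqrt(m(1-m))\<close>

text \<open>The square of the right side exceeds 1 + x by -x^3/8 + x^4/64, which is nonnegative for
  \<open>x \<le> 0\<close>.\<close>

lemma sqrt_one_plus_le:
  fixes x :: real
  assumes "- 1 \<le> x" "x \<le> 0"
  shows "sqrt (1 + x) \<le> 1 + x / 2 - x\<^sup>2 / 8"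
proof (rule real_le_lsqrt)
  have "x\<^sup>2 \<le> 1" using assms by (simp add: abs_square_le_1)
  then show "0 \<le> 1 + x / 2 - x\<^sup>2 / 8" using assms by simp
  have "0 \<le> - x * x\<^sup>2" using assms by (intro mult_nonneg_nonneg) auto
  moreover have "(1 + x / 2 - x\<^sup>2 / 8)\<^sup>2 = 1 + x + (- x * x\<^sup>2) / 8 + (x\<^sup>2)\<^sup>2 / 64"
    by (simp add: power2_eq_square field_simps)
  ultimately show "1 + x \<le> (1 + x / 2 - x\<^sup>2 / 8)\<^sup>2"
    by (smt (verit) divide_nonneg_nonneg zero_le_power2)
qed

text \<open>The tangent at \<open>a\<close>, corrected below \<open>a\<close> by the second-order
  Taylor term: for f(a) = sqrt(a(1-a)) one has -f''(a) = 1/(4 s^3).\<close>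

lemma sqrt_variance_le_tangent:
  fixes a m :: real
  assumes a: "0 < a" "a \<le> 1 / 2" and m: "0 \<le> m" "m \<le> 1"
  defines "s \<equiv> sqrt (a * (1 - a))"
  shows "sqrt (m * (1 - m)) \<le> s + (1 - 2 * a) * (m - a) / (2 * s) - (max 0 (a - m))\<^sup>2 / (8 * s ^ 3)"
proof -
  have s2: "s\<^sup>2 = a * (1 - a)" and s: "0 < s" using a by (auto simp: s_def)
  have sq: "sqrt (m * (1 - m)) = s * sqrt (1 + (m * (1 - m) - s\<^sup>2) / s\<^sup>2)"
  proof -
    have "1 + (m * (1 - m) - s\<^sup>2) / s\<^sup>2 = m * (1 - m) / s\<^sup>2"
      using s by (simp add: diff_divide_distrib)
    then show ?thesis using s by (simp add: real_sqrt_divide)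
  qed
  show ?thesis
  proof (cases "m \<le> a")
    case True
    define h where "h = a - m"
    have h: "0 \<le> h" "m = a - h" using True by (auto simp: h_def)
    define x where "x = (m * (1 - m) - s\<^sup>2) / s\<^sup>2"
    have xs: "x * s\<^sup>2 = - h * (1 - 2 * a + h)"
      using s unfolding x_def s2 h by (simp add: s2[symmetric]) (simp add: s2 algebra_simps)
    have "x \<ge> - 1" using s m by (simp add: x_def field_simps mult_left_le)
    \<comment> \<open>Here \<open>a \<le> 1 / 2\<close> enters: m(1-m) is increasing up to
      \<open>a\<close>.\<close>
    moreover have "x \<le> 0"
    proof -
      have "x * s\<^sup>2 \<le> 0" unfolding xs using h a by (simp add: mult_nonneg_nonneg)
      then show ?thesis using s by (simp add: mult_le_0_iff)
    qed
    ultimately have "sqrt (m * (1 - m)) \<le> s * (1 + x / 2 - x\<^sup>2 / 8)"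
      unfolding sq x_def[symmetric] using sqrt_one_plus_le s by (simp add: mult_left_mono)
    also have "\<dots> = s + x * s\<^sup>2 / (2 * s) - (x * s\<^sup>2)\<^sup>2 / (8 * s ^ 3)"
      using s by (simp add: field_simps power2_eq_square power3_eq_cube)
    also have "\<dots> = s - (1 - 2 * a) * h / (2 * s) - h\<^sup>2 * (4 * s\<^sup>2 + (1 - 2 * a + h)\<^sup>2) / (8 * s ^ 3)"
      unfolding xs using s by (simp add: field_simps power2_eq_square power3_eq_cube)
    also have "\<dots> \<le> s - (1 - 2 * a) * h / (2 * s) - h\<^sup>2 * 1 / (8 * s ^ 3)"
    proof -
      \<comment> \<open>The constant 1 comes from 4a(1-a) + (1-2a)^2 = 1.\<close>
      have "(1 - 2 * a)\<^sup>2 \<le> (1 - 2 * a + h)\<^sup>2" using h a by (intro power_mono) auto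
      then have "1 \<le> 4 * s\<^sup>2 + (1 - 2 * a + h)\<^sup>2"
        unfolding s2 by (simp add: power2_eq_square algebra_simps)
      then show ?thesis using s by (intro diff_left_mono divide_right_mono mult_left_mono) auto
    qed
    finally have "sqrt (m * (1 - m)) \<le> s - (1 - 2 * a) * h / (2 * s) - h\<^sup>2 / (8 * s ^ 3)"
      by simp
    moreover have "m - a = - h" "max 0 (a - m) = h" using True by (auto simp: h_def)
    ultimately show ?thesis by simp
  next
    case False
    \<comment> \<open>Above \<open>a\<close> the plain tangent bound suffices; it follows from the
      arithmetic-geometric mean inequality.\<close>
    have "0 \<le> (sqrt (m * (1 - m)) - s)\<^sup>2" by simp
    then have "2 * s * sqrt (m * (1 - m)) \<le> m * (1 - m) + s\<^sup>2"
      using m by (simp add: power2_diff mult_ac)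
    also have "\<dots> = 2 * s\<^sup>2 + (1 - 2 * a) * (m - a) - (m - a)\<^sup>2"
      unfolding s2 by (simp add: power2_eq_square algebra_simps)
    also have "\<dots> \<le> 2 * s\<^sup>2 + (1 - 2 * a) * (m - a)" by simp
    finally have "sqrt (m * (1 - m)) \<le> (2 * s\<^sup>2 + (1 - 2 * a) * (m - a)) / (2 * s)"
      using s by (simp add: field_simps)
    also have "\<dots> = s + (1 - 2 * a) * (m - a) / (2 * s)"
      using s by (simp add: field_simps power2_eq_square)
    finally show ?thesis using False by simp
  qed
qed

section \<open>Symmetry under complementation\<close>

text \<open>The level set of \<open>- A\<close> at \<open>u\<close> is the complement of that of
  \<open>A\<close> at \<open>1 - u\<close>, except at the finitely many \<open>u\<close> with
  \<open>g y = 1 - u\<close> for some \<open>y\<close>. The substitution of \<open>1 - u\<close> for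
  \<open>u\<close> and the symmetry of \<open>f\<close> finish the argument.\<close>

lemma cong_quot_compl:
  fixes P :: "'v::finite \<Rightarrow> 'v \<Rightarrow> real"
  assumes "markov_kernel P" "irreducible_kernel P" and st: "stationary_distribution P \<pi>"
    and sym: "\<And>x. f (1 - x) = f x"
  shows "cong_quot P \<pi> f (- A) = cong_quot P \<pi> f A"
proof -
  have pos: "\<And>y. 0 < \<pi> y" using stationary_positive assms by blast
  have meas_compl: "sum \<pi> (- D) = 1 - sum \<pi> D" for D
    using st by (simp add: stationary_distribution_def Compl_eq_Diff_UNIV sum_diff)
  define g where "g y = flow P \<pi> A {y} / \<pi> y" for y
  have "evolve P \<pi> (- A) u = {y. u \<le> flow P \<pi> (- A) {y} / \<pi> y}" for u
    using pos by (auto simp: evolve_def pos_le_divide_eq)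
  then have ev: "evolve P \<pi> (- A) u = {y. g y \<le> 1 - u}" for u
    using flow_ratio_compl[OF st pos] by (auto simp: g_def)
  have ev': "evolve P \<pi> A u = {y. u \<le> g y}" for u
    using pos by (auto simp: evolve_def g_def pos_le_divide_eq)
  obtain w :: "'v set \<Rightarrow> real" where w: "\<forall>F. ((\<lambda>u. F {y. u \<le> g y}) has_integral (\<Sum>D\<in>UNIV. w D * F D)) {0..1}"
    by (rule superlevel_integral_weights[of g]) (rule that)
  define I where "I = (\<Sum>D\<in>UNIV. w D * f (sum \<pi> D))"
  have I: "((\<lambda>u. f (sum \<pi> (evolve P \<pi> A u))) has_integral I) {0..1}"
    using w[rule_format, of "\<lambda>D. f (sum \<pi> D)"] by (simp add: I_def ev')
  have "((\<lambda>u. f (sum \<pi> (evolve P \<pi> A (1 - u)))) has_integral I) {0..1}"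
  proof -
    have "(\<lambda>u::real. 1 - u) ` {0..1} = {0..1}" by simp
    then show ?thesis
      using has_integral_affinity[of "\<lambda>u. f (sum \<pi> (evolve P \<pi> A u))" I 0 1 "- 1" 1] I by simp
  qed
  then have "((\<lambda>u. f (sum \<pi> (evolve P \<pi> (- A) u))) has_integral I) {0..1}"
  proof (rule has_integral_spike_finite[of "range (\<lambda>y. 1 - g y)", rotated -1])
    show "f (sum \<pi> (evolve P \<pi> (- A) u)) = f (sum \<pi> (evolve P \<pi> A (1 - u)))"
      if u: "u \<in> {0..1} - range (\<lambda>y. 1 - g y)" for u
    proof -
      have "g y \<noteq> 1 - u" for y
      proof
        assume "g y = 1 - u"
        then have "u = 1 - g y" by simp
        then show False using u by blast
      qed
      then have "g y \<le> 1 - u \<longleftrightarrow> \<not> 1 - u \<le> g y" for y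
        by (metis order.antisym linear)
      then have "evolve P \<pi> (- A) u = - evolve P \<pi> A (1 - u)"
        unfolding ev ev' by auto
      then show ?thesis using sym by (simp add: meas_compl)
    qed
  qed auto
  with I show ?thesis
    by (simp add: cong_quot_def integral_unique meas_compl sym)
qed

section \<open>The two identities, the inequality and the symmetry\<close>

theorem lemma4p3p3:
  fixes P :: "'v::finite \<Rightarrow> 'v \<Rightarrow> real" and \<pi> :: "'v \<Rightarrow> real" and A :: "'v set"
  assumes "markov_kernel P" and "irreducible_kernel P" and "stationary_distribution P \<pi>"
    and "A \<noteq> {}" and "A \<noteq> UNIV"
  shows "1 - cong_quot P \<pi> (\<lambda>a. a * (1 - a)) A = 2 * sum \<pi> A * sum \<pi> (- A) * psi_gl P \<pi> A
    \<and> 1 - cong_quot P \<pi> (\<lambda>a. a * ln (1 / a)) A = psi_mod P \<pi> A / ln (1 / sum \<pi> A)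
    \<and> (sum \<pi> A \<le> 1 / 2 \<longrightarrow>
         1 - cong_quot P \<pi> (\<lambda>a. sqrt (a * (1 - a))) A \<ge> 1 / 4 * psi_plus P \<pi> A)
    \<and> 1 - cong_quot P \<pi> (\<lambda>a. sqrt (a * (1 - a))) A
        = 1 - cong_quot P \<pi> (\<lambda>a. sqrt (a * (1 - a))) (- A)"
proof -
  define a where "a = sum \<pi> A"
  have pos: "\<And>y. 0 < \<pi> y" using stationary_positive assms by blast
  have one: "sum \<pi> UNIV = 1" using assms by (simp add: stationary_distribution_def)
  have meas_compl: "sum \<pi> (- D) = 1 - sum \<pi> D" for D
    using one by (simp add: Compl_eq_Diff_UNIV sum_diff)
  have meas: "0 \<le> sum \<pi> D" "sum \<pi> D \<le> 1" for D
    using meas_compl[of D] sum_nonneg[of D \<pi>] sum_nonneg[of "- D" \<pi>] pos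
    by (auto simp: less_imp_le)
  have a0: "0 < a" unfolding a_def using assms pos by (intro sum_pos) auto
  have "0 < sum \<pi> (- A)" using assms pos by (intro sum_pos) auto
  then have a1: "a < 1" by (simp add: meas_compl a_def)
  obtain w :: "'v set \<Rightarrow> real" where w: "\<forall>D. 0 \<le> w D"
    and int: "\<forall>F. ((\<lambda>u. F (evolve P \<pi> A u)) has_integral (\<Sum>D\<in>UNIV. w D * F D)) {0..1}"
    and w1: "(\<Sum>D\<in>UNIV. w D) = 1" and wa: "(\<Sum>D\<in>UNIV. w D * sum \<pi> D) = a"
    and bl: "\<forall>t\<in>{0..1}.
      blocking P \<pi> (- A) t = (\<Sum>D\<in>UNIV. w D * deviation a (sum \<pi> D) t)"
    by (rule evolve_weights[OF assms(1-3,5), folded a_def]) (rule that)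
  have cq: "cong_quot P \<pi> f A = (\<Sum>D\<in>UNIV. w D * f (sum \<pi> D)) / f a" for f
    using integral_unique[OF int[rule_format, of "\<lambda>D. f (sum \<pi> D)"]] by (simp add: cong_quot_def a_def)
  \<comment> \<open>The finite sum over \<open>D\<close> replaces an application of Fubini: only
    one-dimensional integrals in \<open>t\<close> remain.\<close>
  have bl_int: "((\<lambda>t. blocking P \<pi> (- A) t * h t) has_integral (\<Sum>D\<in>UNIV. w D * J D)) S"
    if "\<And>D. ((\<lambda>t. deviation a (sum \<pi> D) t * h t) has_integral J D) S" "S \<subseteq> {0..1}" for h J S
  proof (rule has_integral_eq)
    show "((\<lambda>t. \<Sum>D\<in>UNIV. w D * (deviation a (sum \<pi> D) t * h t)) has_integral
        (\<Sum>D\<in>UNIV. w D * J D)) S"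
      by (intro has_integral_sum has_integral_mult_right that) auto
  qed (use that in \<open>auto simp: bl sum_distrib_right mult.assoc subset_iff\<close>)
  have part1: "1 - cong_quot P \<pi> (\<lambda>a. a * (1 - a)) A = 2 * a * (1 - a) * psi_gl P \<pi> A"
  proof -
    define K where "K = 1 / (a\<^sup>2 * (1 - a)\<^sup>2)"
    have "((\<lambda>t. blocking P \<pi> (- A) t * K) has_integral
        (\<Sum>D\<in>UNIV. w D * ((a - sum \<pi> D)\<^sup>2 / 2 * K))) {0..1}"
      using a0 a1 meas by (intro bl_int has_integral_mult_left has_integral_deviation) auto
    then have "psi_gl P \<pi> A = (\<Sum>D\<in>UNIV. w D * ((a - sum \<pi> D)\<^sup>2 / 2 * K))"
      by (auto simp: psi_gl_def a_def[symmetric] meas_compl K_def dest: integral_unique)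
    \<comment> \<open>Uses (a-m)^2 = a^2 + (1-2a)m - m(1-m); the affine part in m is evaluated by
      \<open>w1\<close> and \<open>wa\<close>.\<close>
    also have "\<dots> = (\<Sum>D\<in>UNIV. K / 2 * (a\<^sup>2 * w D + (1 - 2 * a) * (w D * sum \<pi> D)
        - w D * (sum \<pi> D * (1 - sum \<pi> D))))"
      by (intro sum.cong) (auto simp: power2_eq_square field_simps)
    also have "\<dots> = K / 2 * (a\<^sup>2 + (1 - 2 * a) * a - (\<Sum>D\<in>UNIV. w D * (sum \<pi> D * (1 - sum \<pi> D))))"
      by (simp only: sum_distrib_left[symmetric] sum.distrib sum_subtractf w1 wa) simp
    finally have eq: "psi_gl P \<pi> A = K / 2 * (a * (1 - a) - (\<Sum>D\<in>UNIV. w D * (sum \<pi> D * (1 - sum \<pi> D))))"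
      by (simp add: algebra_simps power2_eq_square)
    have "2 * a * (1 - a) * (K / 2 * X) = X / (a * (1 - a))" for X
      using a0 a1 by (simp add: K_def power2_eq_square)
    then show ?thesis
      unfolding eq cq using a0 a1 by (simp add: diff_divide_distrib)
  qed
  have part2: "1 - cong_quot P \<pi> (\<lambda>a. a * ln (1 / a)) A = psi_mod P \<pi> A / ln (1 / a)"
  proof -
    define H where "H = (\<Sum>D\<in>UNIV. w D * (sum \<pi> D * ln (1 / sum \<pi> D)))"
    \<comment> \<open>Both sides are 0 at \<open>x = 0\<close>, in agreement with the convention for
      a log(1/a).\<close>
    have ln_inv: "x * ln (1 / x) = - (x * ln x)" for x :: real
      by (simp add: ln_div)
    have "((\<lambda>t. deviation a (sum \<pi> D) t * (1 / t * (1 / a))) has_integral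
        (sum \<pi> D * ln (sum \<pi> D) - sum \<pi> D * ln a - sum \<pi> D + a) * (1 / a)) {0..1}" for D
      using has_integral_mult_left[OF has_integral_deviation_divide[of a "sum \<pi> D"], of "1 / a"]
        a0 a1 meas[of D] by simp
    from bl_int[OF this order_refl]
    have "psi_mod P \<pi> A = (\<Sum>D\<in>UNIV. w D * ((sum \<pi> D * ln (sum \<pi> D) - sum \<pi> D * ln a - sum \<pi> D + a) * (1 / a)))"
      by (auto simp: psi_mod_def a_def[symmetric] dest: integral_unique)
    also have "\<dots> = (\<Sum>D\<in>UNIV. 1 / a * (a * w D - (ln a + 1) * (w D * sum \<pi> D)
        - w D * (sum \<pi> D * ln (1 / sum \<pi> D))))"
      by (intro sum.cong) (auto simp: ln_inv algebra_simps)
    also have "\<dots> = 1 / a * (a - (ln a + 1) * a - H)"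
      unfolding H_def by (simp only: sum_distrib_left[symmetric] sum.distrib sum_subtractf w1 wa) simp
    finally have eq: "psi_mod P \<pi> A = (a * ln (1 / a) - H) / a"
      using a0 by (simp add: ln_inv field_simps)
    have "ln (1 / a) > 0" using a0 a1 by simp
    then have "1 - H / (a * ln (1 / a)) = (a * ln (1 / a) - H) / a / ln (1 / a)"
      using a0 by (simp only: diff_divide_distrib) simp
    then show ?thesis unfolding eq cq H_def[symmetric] .
  qed
  have part3: "1 - cong_quot P \<pi> (\<lambda>a. sqrt (a * (1 - a))) A \<ge> 1 / 4 * psi_plus P \<pi> A" if half: "a \<le> 1 / 2"
  proof -
    define s where "s = sqrt (a * (1 - a))"
    have s2: "s\<^sup>2 = a * (1 - a)" and s: "0 < s" using a0 a1 by (auto simp: s_def)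
    define K where "K = 1 / (a\<^sup>2 * (1 - a)\<^sup>2)"
    have K: "K = 1 / s ^ 4"
      using arg_cong[OF s2, of "\<lambda>x. x\<^sup>2"] by (simp add: K_def power_mult_distrib)
    \<comment> \<open>Restricting \<open>t\<close> to [0,a] retains only the sets with measure below
      \<open>a\<close>, hence the positive part.\<close>
    have dev: "(deviation a m has_integral (max 0 (a - m))\<^sup>2 / 2) {0..a}" if "0 \<le> m" for m
    proof (cases "m \<le> a")
      case True
      then show ?thesis using has_integral_deviation[of a m "{0..a}"] that by simp
    next
      case False
      then have "((\<lambda>t. 0) has_integral 0) {0..a}" by simp
      then have "(deviation a m has_integral 0) {0..a}"
        by (rule has_integral_eq[rotated]) (use False in \<open>auto simp: deviation_def\<close>)
      then show ?thesis using False by simp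
    qed
    have "((\<lambda>t. blocking P \<pi> (- A) t * K) has_integral
        (\<Sum>D\<in>UNIV. w D * ((max 0 (a - sum \<pi> D))\<^sup>2 / 2 * K))) {0..a}"
      using a0 a1 meas by (intro bl_int has_integral_mult_left dev) auto
    then have plus: "psi_plus P \<pi> A = (\<Sum>D\<in>UNIV. w D * ((max 0 (a - sum \<pi> D))\<^sup>2 / 2 * K))"
      by (auto simp: psi_plus_def a_def[symmetric] meas_compl K_def dest: integral_unique)
    have "(\<Sum>D\<in>UNIV. w D * sqrt (sum \<pi> D * (1 - sum \<pi> D)))
        \<le> (\<Sum>D\<in>UNIV. w D * (s + (1 - 2 * a) * (sum \<pi> D - a) / (2 * s)
            - (max 0 (a - sum \<pi> D))\<^sup>2 / (8 * s ^ 3)))"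
      unfolding s_def using a0 half meas w
      by (intro sum_mono mult_left_mono sqrt_variance_le_tangent) auto
    \<comment> \<open>Since \<open>K\<close> is 1/s^4, the correction z^2/(8 s^3) equals s/4 times
      (z^2/2) \<open>K\<close>, the integrand of \<open>psi_plus\<close> after integration. Division
      by f(a) = \<open>s\<close> then leaves the constant 1/4.\<close>
    also have "\<dots> = (\<Sum>D\<in>UNIV. s * w D + (1 - 2 * a) / (2 * s) * (w D * sum \<pi> D)
        - (1 - 2 * a) / (2 * s) * a * w D - s / 4 * (w D * ((max 0 (a - sum \<pi> D))\<^sup>2 / 2 * K)))"
      using s by (intro sum.cong) (auto simp: K field_simps power3_eq_cube power4_eq_xxxx)
    \<comment> \<open>The tangent term vanishes because \<open>w\<close> has mean measure
      \<open>a\<close>.\<close>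
    also have "\<dots> = s - s / 4 * psi_plus P \<pi> A"
      unfolding plus by (simp only: sum_distrib_left[symmetric] sum.distrib sum_subtractf w1 wa)
    finally show ?thesis unfolding cq s_def[symmetric] using s by (simp add: field_simps)
  qed
  have "cong_quot P \<pi> (\<lambda>a. sqrt (a * (1 - a))) (- A) = cong_quot P \<pi> (\<lambda>a. sqrt (a * (1 - a))) A"
    by (rule cong_quot_compl[OF assms(1-3)]) (simp add: mult.commute)
  then show ?thesis using part1 part2 part3 by (simp add: meas_compl a_def)
qed

end
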